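(* Let $F_0(x),F_1(x),F_2(x),\ldots$ be any family of polynomials in $x$ with complex coefficients such that $F_n(x)$ has degree $\le n$ for every $n\ge 0$. If $$F_n(2x)=\sum_{k=0}^nF_k(x)\,F_{n-k}(x)$$ holds for all integers $n\ge 0$ and all $x$, then the following identities hold for all integers $n\ge 0$ and all complex $x$, $y$, and $t$: $$\frac{(x+y)\,F_n(x+y+tn)}{x+y+tn}=\sum_{k=0}^n \frac{x\,F_k(x+tk)}{x+tk}\cdot\frac{y\,F_{n-k}\bigl(y+t(n-k)\bigr)}{y+t(n-k)}\,;$$ $$\frac{n\,F_n(x+y+tn)}{x+y+tn}=\sum_{k=1}^n\frac{k\,F_k(x+tk)}{x+tk}\cdot\frac{y\,F_{n-k}\bigl(y+t(n-k)\bigr)}{y+t(n-k)}\,.$$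
   Context: Quotients are interpreted as follows. Under the hypothesis, $F_m(0)=0$ for every $m\ge1$, so $F_m(u)/u$ denotes the polynomial obtained by dividing $F_m(u)$ by $u$, evaluated at the indicated $u$ (including $u=0$). For index $0$, the expression $xF_0(x)/x$ denotes $F_0(x)$ (similarly with $y$ or $x+y$ in place of $x$), and the left side of the second identity is $0$ when $n=0$. *)

theory Defs
  imports Complex_Main "HOL-Computational_Algebra.Polynomial"
begin

text \<open>The quotient \<open>p(u)/u\<close> is the value at \<open>u\<close> of the polynomial obtained by dividing
  \<open>p\<close> by its indeterminate. The division is exact when \<open>p(0) = 0\<close>, which
  holds for \<open>F\<^sub>m\<close> with \<open>m \<ge> 1\<close> under the convolution hypothesis (last lemma below).\<close>

definition quot_at :: "complex poly \<Rightarrow> complex \<Rightarrow> complex" where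
  "quot_at p u = poly (p div [:0, 1:]) u"

text \<open>\<open>scaled_quot F t k x\<close> is \<open>x F\<^sub>k(x + t k) / (x + t k)\<close>. For \<open>k = 0\<close> the two factors
  \<open>x\<close> cancel, giving \<open>F\<^sub>0(x)\<close>, also at \<open>x = 0\<close>.\<close>

definition scaled_quot :: "(nat \<Rightarrow> complex poly) \<Rightarrow> complex \<Rightarrow> nat \<Rightarrow> complex \<Rightarrow> complex" where
  "scaled_quot F t k x =
     (if k = 0 then poly (F 0) x else x * quot_at (F k) (x + t * of_nat k))"

lemma quot_at_exact:
  assumes "poly p 0 = 0"
  shows "u * quot_at p u = poly p u"
proof -
  have "[:0, 1:] dvd p"
    using assms poly_eq_0_iff_dvd[of p 0] by simp
  then have "p = [:0, 1:] * (p div [:0, 1:])"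
    by (rule dvd_mult_div_cancel [symmetric])
  then have "poly p u = poly ([:0, 1:] * (p div [:0, 1:])) u"
    by simp
  then show ?thesis
    by (simp add: quot_at_def)
qed

lemma convolution_poly_at_0:
  fixes F :: "nat \<Rightarrow> complex poly"
  assumes "\<And>n x. poly (F n) (2 * x) = (\<Sum>k=0..n. poly (F k) x * poly (F (n - k)) x)"
    and "m \<ge> 1"
  shows "poly (F m) 0 = 0"
  using assms(2)
proof (induction m rule: less_induct)
  case (less m)
  let ?a = "\<lambda>k. poly (F k) 0"
  have conv: "?a n = (\<Sum>k=0..n. ?a k * ?a (n - k))" for n
    using assms(1)[of n 0] by simp
  obtain j where m: "m = Suc j"
    using less.prems by (cases m) auto
  have "(\<Sum>k=1..j. ?a k * ?a (m - k)) = 0"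
    using less.IH m by (intro sum.neutral) auto
  moreover have "(\<Sum>k=0..m. ?a k * ?a (m - k))
      = ?a 0 * ?a m + (\<Sum>k=1..j. ?a k * ?a (m - k)) + ?a m * ?a 0"
    unfolding m by (simp add: sum.atLeast_Suc_atMost)
  ultimately have "?a m = 2 * ?a 0 * ?a m"
    using conv[of m] by simp
  moreover have "?a 0 = 0 \<or> ?a 0 = 1"
    using conv[of 0] by simp
  ultimately show ?case
    by auto
qed

end

(* If F_0 = 1, the doubling relation says that the power series A(x) = sum F_n(x) z^n satisfies
   A(2x) = A(x)^2, so A(x) = A(1)^x for x = 2^j; coefficients being polynomials in x, this holds
   for all x. With L = A(1)'/A(1) and g the compositional inverse of h(z) = z A(1)^(-t), Lagrange
   inversion shows that the terms of the two identities are the coefficients of S(x) = A(x) o g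
   and T(x) = ((L A(x)) o g) g', and then S(x) S(y) = S(x + y) and T(x) S(y) = T(x + y) because
   A(x) A(y) = A(x + y). *)

theory Submission
  imports Defs "HOL-Computational_Algebra.Formal_Power_Series"
begin

unbundle fps_syntax

section \<open>Complex powers of a formal power series\<close>

text \<open>Meaningful only for \<open>f\<close> with constant term 1.\<close>

definition fps_cpow :: "complex fps \<Rightarrow> complex \<Rightarrow> complex fps" where
  "fps_cpow f x = fps_binomial x oo (f - 1)"

definition fps_log_deriv :: "complex fps \<Rightarrow> complex fps" where
  "fps_log_deriv f = fps_deriv f * inverse f"

lemma fps_cpow_nth_0 [simp]: "fps_cpow f x $ 0 = 1"
  by (simp add: fps_cpow_def)

lemma fps_cpow_0 [simp]: "fps_cpow f 0 = 1"
  by (simp add: fps_cpow_def)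

lemma fps_cpow_add:
  assumes "f $ 0 = 1"
  shows "fps_cpow f (x + y) = fps_cpow f x * fps_cpow f y"
  using assms by (simp add: fps_cpow_def fps_binomial_add_mult fps_compose_mult_distrib)

lemma fps_cpow_of_nat:
  assumes "f $ 0 = 1"
  shows "fps_cpow f (of_nat n) = f ^ n"
proof -
  have "fps_cpow f (of_nat n) = ((1 + fps_X) oo (f - 1)) ^ n"
    using assms by (simp add: fps_cpow_def fps_binomial_of_nat fps_compose_power)
  also have "(1 + fps_X) oo (f - 1) = f"
    using assms by (simp add: fps_compose_add_distrib)
  finally show ?thesis .
qed

lemma fps_cpow_power:
  assumes "f $ 0 = 1"
  shows "fps_cpow f x ^ n = fps_cpow f (of_nat n * x)"
  using assms by (induction n) (simp_all add: fps_cpow_add ring_distribs)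

text \<open>Chain rule for the binomial series: its derivative brings down \<open>x\<close> and a
  factor \<open>inverse (1 + fps_X)\<close>, which composition with \<open>f - 1\<close> turns into
  \<open>inverse f\<close>.\<close>

lemma fps_deriv_cpow:
  assumes "f $ 0 = 1"
  shows "fps_deriv (fps_cpow f x) = fps_const x * (fps_log_deriv f * fps_cpow f x)"
proof -
  have f0: "(f - 1) $ 0 = 0"
    using assms by simp
  have "(1 + fps_X) oo (f - 1) = f"
    using assms by (simp add: fps_compose_add_distrib)
  then have inv: "inverse (1 + fps_X) oo (f - 1) = inverse f"
    using f0 by (simp add: fps_inverse_compose)
  have "fps_deriv (fps_cpow f x) = (fps_deriv (fps_binomial x) oo (f - 1)) * fps_deriv f"
    using fps_compose_deriv[OF f0, of "fps_binomial x"] by (simp add: fps_cpow_def)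
  also have "fps_deriv (fps_binomial x) = fps_const x * fps_binomial x * inverse (1 + fps_X)"
    by (simp add: fps_binomial_deriv fps_divide_unit)
  also have "(\<dots> oo (f - 1)) = fps_const x * fps_cpow f x * inverse f"
    by (simp add: fps_compose_mult_distrib[OF f0] inv fps_cpow_def)
  finally show ?thesis
    by (simp add: fps_log_deriv_def mult_ac)
qed

section \<open>Polynomial dependence on the exponent, and the doubling relation\<close>

lemma poly_gbinomial:
  fixes x :: "'a::field_char_0"
  shows "poly (smult (inverse (fact k)) (\<Prod>i=0..<k. [:- of_nat i, 1:])) x = x gchoose k"
  by (simp add: gbinomial_prod_rev poly_prod divide_inverse mult.commute)

text \<open>Coefficient \<open>n\<close> of the composition is a finite combination of
  \<open>x gchoose k\<close> with \<open>k\<close> \<le> \<open>n\<close>, each a polynomial in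
  \<open>x\<close>.\<close>

lemma fps_cpow_nth_poly: "\<exists>p. \<forall>x. fps_cpow f x $ n = poly p x"
proof (intro exI allI)
  fix x
  show "fps_cpow f x $ n = poly (\<Sum>k=0..n. smult ((f - 1) ^ k $ n)
      (smult (inverse (fact k)) (\<Prod>i=0..<k. [:- of_nat i, 1:]))) x"
    unfolding fps_cpow_def fps_compose_nth fps_binomial_nth poly_sum poly_smult[of "(f - 1) ^ _ $ n"]
      poly_gbinomial by (simp add: mult.commute)
qed

text \<open>In characteristic 0 the powers of 2 are infinitely many. They are the points that
  repeated doubling reaches from 1.\<close>

lemma poly_eq_on_powers_of_2:
  fixes p q :: "'a::field_char_0 poly"
  assumes "\<And>j. poly p (2 ^ j) = poly q (2 ^ j)"
  shows "p = q"
proof (rule ccontr)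
  assume "p \<noteq> q"
  then have "finite {x. poly (p - q) x = 0}"
    by (intro poly_roots_finite) simp
  moreover have "range (\<lambda>j. 2 ^ j) \<subseteq> {x. poly (p - q) x = 0}"
    using assms by auto
  moreover have "inj (\<lambda>j. 2 ^ j :: 'a)"
  proof (rule injI)
    fix i j assume "(2 ^ i :: 'a) = 2 ^ j"
    then have "of_nat (2 ^ i) = (of_nat (2 ^ j) :: 'a)"
      by simp
    then have "(2 :: nat) ^ i = 2 ^ j"
      by (rule of_nat_eq_iff[THEN iffD1])
    then show "i = j"
      by simp
  qed
  ultimately show False
    using finite_subset range_inj_infinite by blast
qed

lemma doubling_family_eq_cpow:
  fixes F :: "nat \<Rightarrow> complex poly"
  assumes conv: "\<And>n x. poly (F n) (2 * x) = (\<Sum>k=0..n. poly (F k) x * poly (F (n - k)) x)"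
    and F0: "F 0 = 1"
  defines "A \<equiv> \<lambda>x. Abs_fps (\<lambda>n. poly (F n) x)"
  shows "A x = fps_cpow (A 1) x"
proof -
  have f0: "A 1 $ 0 = 1"
    by (simp add: A_def F0)
  have double: "A (2 * y) = A y * A y" for y
    by (rule fps_ext) (simp add: A_def conv fps_mult_nth)
  have pow2: "A (2 ^ j) = fps_cpow (A 1) (2 ^ j)" for j
  proof (induction j)
    case 0
    then show ?case
      using fps_cpow_of_nat[OF f0, of 1] by simp
  next
    case (Suc j)
    then show ?case
      using double[of "2 ^ j"] fps_cpow_add[OF f0, of "2 ^ j" "2 ^ j"] by simp
  qed
  show ?thesis
  proof (rule fps_ext)
    fix n
    obtain p where p: "\<And>x. fps_cpow (A 1) x $ n = poly p x"
      using fps_cpow_nth_poly by blast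
    have "F n = p"
    proof (rule poly_eq_on_powers_of_2)
      show "poly (F n) (2 ^ j) = poly p (2 ^ j)" for j
        using arg_cong[OF pow2, of "\<lambda>a. a $ n" j] p by (simp add: A_def)
    qed
    then show "A x $ n = fps_cpow (A 1) x $ n"
      using p by (simp add: A_def)
  qed
qed

section \<open>Lagrange inversion\<close>

text \<open>As \<open>h\<close> has no constant term, \<open>h ^ k\<close> starts at degree
  \<open>k\<close> or later; the inner sum can thus run to \<open>m\<close> for every
  \<open>i\<close>, and the two sums can be swapped.\<close>

lemma fps_compose_mult_nth:
  fixes u h g :: "'a::comm_ring_1 fps"
  assumes "h $ 0 = 0"
  shows "((u oo h) * g) $ m = (\<Sum>k=0..m. u $ k * (h ^ k * g) $ m)"
proof -
  have "((u oo h) * g) $ m = (\<Sum>i=0..m. (\<Sum>k=0..i. u $ k * h ^ k $ i) * g $ (m - i))"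
    by (simp add: fps_mult_nth fps_compose_nth)
  also have "\<dots> = (\<Sum>i=0..m. (\<Sum>k=0..m. u $ k * h ^ k $ i) * g $ (m - i))"
  proof (rule sum.cong)
    fix i assume i: "i \<in> {0..m}"
    have "(\<Sum>k=0..i. u $ k * h ^ k $ i) = (\<Sum>k=0..m. u $ k * h ^ k $ i)"
      using i assms by (intro sum.mono_neutral_left) (auto simp: startsby_zero_power_prefix)
    then show "(\<Sum>k=0..i. u $ k * h ^ k $ i) * g $ (m - i)
        = (\<Sum>k=0..m. u $ k * h ^ k $ i) * g $ (m - i)"
      by simp
  qed simp
  also have "\<dots> = (\<Sum>k=0..m. \<Sum>i=0..m. u $ k * h ^ k $ i * g $ (m - i))"
    by (simp only: sum_distrib_right) (rule sum.swap)
  also have "\<dots> = (\<Sum>k=0..m. u $ k * (h ^ k * g) $ m)"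
    by (simp add: fps_mult_nth sum_distrib_left mult.assoc)
  finally show ?thesis .
qed

text \<open>In residue form: \<open>(u \<circ> h) h' / h\<^sup>m\<^sup>+\<^sup>1\<close> has residue \<open>u\<^sub>m\<close> for \<open>h = z f\<^sup>-\<^sup>t\<close>.\<close>

lemma cpow_residue:
  fixes f u :: "complex fps" and t :: complex
  assumes f0: "f $ 0 = 1"
  defines "h \<equiv> fps_X * fps_cpow f (- t)"
  shows "((u oo h) * fps_deriv h * fps_cpow f (t * of_nat (Suc m))) $ m = u $ m"
proof -
  define W where "W = 1 - fps_const t * (fps_X * fps_log_deriv f)"
  have h0: "h $ 0 = 0"
    by (simp add: h_def)
  have deriv_h: "fps_deriv h = fps_cpow f (- t) * W"
    by (simp add: h_def W_def fps_deriv_cpow[OF f0] algebra_simps flip: fps_const_neg)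
  \<comment> \<open>For \<open>j\<close> > 0, comparing coefficients in the derivative of the power
    shows that its coefficient \<open>j\<close> is exactly what the second term of \<open>W\<close>
    subtracts.\<close>
  have delta: "(fps_cpow f (t * of_nat j) * W) $ j = (if j = 0 then 1 else 0)" for j
  proof (cases j)
    case 0
    then show ?thesis by (simp add: W_def)
  next
    case (Suc i)
    let ?a = "fps_cpow f (t * of_nat j)"
    have "(fps_deriv ?a) $ i = (t * of_nat j) * (fps_log_deriv f * ?a) $ i"
      by (simp only: fps_deriv_cpow[OF f0] fps_mult_left_const_nth)
    then have "of_nat j * (?a $ j) = of_nat j * (t * (fps_log_deriv f * ?a) $ i)"
      by (simp add: Suc mult_ac)
    then have "?a $ j = t * (fps_log_deriv f * ?a) $ i"
      using Suc by (simp del: of_nat_Suc)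
    moreover have "?a * W = ?a - fps_const t * (fps_X * (fps_log_deriv f * ?a))"
      by (simp add: W_def algebra_simps)
    ultimately show ?thesis
      using Suc by simp
  qed
  have power_coeff: "(h ^ k * (fps_deriv h * fps_cpow f (t * of_nat (Suc m)))) $ m
      = (if k = m then 1 else 0)" if "k \<le> m" for k
  proof -
    \<comment> \<open>Exponents of \<open>f\<close> contributed by \<open>h ^ k\<close>,
      \<open>fps_deriv h\<close> and the last factor. The power \<open>fps_X ^ k\<close> lowers the
      index to \<open>m - k\<close> as well, so \<open>delta\<close> applies.\<close>
    have "- t * of_nat k + (- t + t * of_nat (Suc m)) = t * of_nat (m - k)"
      using that by (simp add: of_nat_diff algebra_simps)
    then have "fps_cpow f (t * of_nat (m - k))
        = fps_cpow f (of_nat k * (- t)) * (fps_cpow f (- t) * fps_cpow f (t * of_nat (Suc m)))"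
      by (simp only: fps_cpow_add[OF f0, symmetric] mult.commute)
    moreover have "h ^ k = fps_X ^ k * fps_cpow f (of_nat k * (- t))"
      by (simp only: h_def power_mult_distrib fps_cpow_power[OF f0])
    ultimately have "h ^ k * (fps_deriv h * fps_cpow f (t * of_nat (Suc m)))
        = fps_X ^ k * (fps_cpow f (t * of_nat (m - k)) * W)"
      by (simp only: deriv_h mult_ac)
    then show ?thesis
      using that delta[of "m - k"] by (simp add: fps_X_power_mult_nth)
  qed
  have "((u oo h) * fps_deriv h * fps_cpow f (t * of_nat (Suc m))) $ m
      = (\<Sum>k=0..m. u $ k * (h ^ k * (fps_deriv h * fps_cpow f (t * of_nat (Suc m)))) $ m)"
    by (simp only: mult.assoc fps_compose_mult_nth[OF h0])
  also have "\<dots> = (\<Sum>k=0..m. if k = m then u $ k else 0)"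
    by (intro sum.cong refl) (simp only: power_coeff atLeastAtMost_iff, simp)
  finally show ?thesis
    by simp
qed

section \<open>Quotients as coefficients, and the two identities\<close>

lemma poly_eq_off_0:
  fixes p q :: "'a::field_char_0 poly"
  assumes "\<And>x. x \<noteq> 0 \<Longrightarrow> poly p x = poly q x"
  shows "p = q"
  by (rule poly_eq_on_powers_of_2) (simp add: assms)

text \<open>Both sides are polynomials in \<open>u\<close>. For nonzero arguments they agree by
  computing coefficient \<open>m\<close> of the derivative of \<open>fps_cpow f x\<close> in two
  ways and cancelling \<open>x\<close>; this forces equality at 0 too.\<close>

lemma quot_at_eq_log_deriv:
  fixes F :: "nat \<Rightarrow> complex poly"
  assumes F0: "poly (F (Suc m)) 0 = 0"
    and f0: "f $ 0 = 1"
    and F: "\<And>n x. fps_cpow f x $ n = poly (F n) x"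
  shows "of_nat (Suc m) * quot_at (F (Suc m)) u = (fps_log_deriv f * fps_cpow f u) $ m"
proof -
  let ?q = "\<Sum>i=0..m. smult (fps_log_deriv f $ i) (F (m - i))"
  have q: "(fps_log_deriv f * fps_cpow f x) $ m = poly ?q x" for x
    by (simp add: fps_mult_nth F poly_sum)
  have "smult (of_nat (Suc m)) (F (Suc m) div [:0, 1:]) = ?q"
  proof (rule poly_eq_off_0)
    fix x :: complex assume x: "x \<noteq> 0"
    have "x * (of_nat (Suc m) * quot_at (F (Suc m)) x) = fps_deriv (fps_cpow f x) $ m"
      using quot_at_exact[OF F0, of x] by (simp add: F algebra_simps)
    also have "\<dots> = x * poly ?q x"
      by (simp only: fps_deriv_cpow[OF f0] fps_mult_left_const_nth q)
    finally show "poly (smult (of_nat (Suc m)) (F (Suc m) div [:0, 1:])) x = poly ?q x"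
      using x by (simp add: quot_at_def)
  qed
  then have "poly (smult (of_nat (Suc m)) (F (Suc m) div [:0, 1:])) u = poly ?q u"
    by simp
  then show ?thesis
    by (simp only: q quot_at_def poly_smult)
qed

lemma convolution_identities:
  fixes F :: "nat \<Rightarrow> complex poly"
  assumes conv: "\<And>n x. poly (F n) (2 * x) = (\<Sum>k=0..n. poly (F k) x * poly (F (n - k)) x)"
    and F0: "F 0 = 1"
  shows "scaled_quot F t n (x + y) = (\<Sum>k=0..n. scaled_quot F t k x * scaled_quot F t (n - k) y)"
    and "of_nat n * quot_at (F n) (x + y + t * of_nat n)
        = (\<Sum>k=1..n. of_nat k * quot_at (F k) (x + t * of_nat k) * scaled_quot F t (n - k) y)"
proof -
  define f where "f = Abs_fps (\<lambda>n. poly (F n) 1)"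
  have f0: "f $ 0 = 1"
    by (simp add: f_def F0)
  have F: "fps_cpow f x $ n = poly (F n) x" for n x
    using doubling_family_eq_cpow[OF conv F0, of x] by (simp add: f_def fps_eq_iff)
  define h where "h = fps_X * fps_cpow f (- t)"
  define g where "g = fps_inv h"
  have h0: "h $ 0 = 0" and h1: "h $ 1 \<noteq> 0"
    by (simp_all add: h_def)
  have g0: "g $ 0 = 0"
    by (simp add: g_def fps_inv_def)
  have gh: "g oo h = fps_X"
    unfolding g_def using h0 h1 by (rule fps_inv)
  define S where "S x = fps_cpow f x oo g" for x
  define T where "T x = ((fps_log_deriv f * fps_cpow f x) oo g) * fps_deriv g" for x
  have SS: "S (x + y) = S x * S y" for x y
    by (simp add: S_def fps_cpow_add[OF f0] fps_compose_mult_distrib[OF g0])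
  have TS: "T (x + y) = T x * S y" for x y
    by (simp add: S_def T_def fps_cpow_add[OF f0] fps_compose_mult_distrib[OF g0] mult_ac)
  have deriv_S: "fps_deriv (S x) = fps_const x * T x" for x
    by (simp add: S_def T_def fps_compose_deriv[OF g0] fps_deriv_cpow[OF f0]
        fps_compose_mult_distrib[OF g0] mult_ac)
  \<comment> \<open>Substituting \<open>h\<close> undoes \<open>g\<close>, and the two derivative
    factors cancel by the chain rule. This brings \<open>T x\<close> into the form needed by
    \<open>cpow_residue\<close>.\<close>
  have Th: "(T x oo h) * fps_deriv h = fps_log_deriv f * fps_cpow f x" for x
  proof -
    have "(fps_deriv g oo h) * fps_deriv h = 1"
      using fps_compose_deriv[OF h0, of g] gh by simp
    then show ?thesis
      by (simp add: T_def fps_compose_mult_distrib[OF h0] gh mult.assoc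
          flip: fps_compose_assoc[OF h0 g0])
  qed
  \<comment> \<open>Index \<open>m\<close> of \<open>T x\<close> belongs to index
    \<open>Suc m\<close> of the family, because \<open>T x\<close> arises from a derivative.\<close>
  have T_nth: "T x $ m = of_nat (Suc m) * quot_at (F (Suc m)) (x + t * of_nat (Suc m))" for x m
  proof -
    have "T x $ m = (fps_log_deriv f * fps_cpow f x * fps_cpow f (t * of_nat (Suc m))) $ m"
      using cpow_residue[OF f0, of "T x" t m] by (simp only: h_def[symmetric] Th)
    also have "\<dots> = (fps_log_deriv f * fps_cpow f (x + t * of_nat (Suc m))) $ m"
      by (simp only: fps_cpow_add[OF f0] mult.assoc)
    also have "\<dots> = of_nat (Suc m) * quot_at (F (Suc m)) (x + t * of_nat (Suc m))"
      using convolution_poly_at_0[OF conv, of "Suc m"]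
      by (intro quot_at_eq_log_deriv[symmetric] f0 F) simp
    finally show ?thesis .
  qed
  \<comment> \<open>Positive indices follow from \<open>deriv_S\<close> on dividing by
    \<open>Suc m\<close>; there is no division by \<open>x\<close>, so \<open>x = 0\<close> is
    covered.\<close>
  have S_nth: "S x $ n = scaled_quot F t n x" for x n
  proof (cases n)
    case 0
    then show ?thesis
      by (simp add: S_def scaled_quot_def F0)
  next
    case (Suc m)
    have "of_nat (Suc m) * S x $ Suc m = fps_deriv (S x) $ m"
      by simp
    also have "\<dots> = of_nat (Suc m) * scaled_quot F t (Suc m) x"
      by (simp only: deriv_S fps_mult_left_const_nth T_nth) (simp add: scaled_quot_def)
    finally show ?thesis
      unfolding Suc by (simp del: of_nat_Suc)
  qed
  show "scaled_quot F t n (x + y) = (\<Sum>k=0..n. scaled_quot F t k x * scaled_quot F t (n - k) y)"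
    by (simp only: S_nth[symmetric] SS fps_mult_nth)
  show "of_nat n * quot_at (F n) (x + y + t * of_nat n)
      = (\<Sum>k=1..n. of_nat k * quot_at (F k) (x + t * of_nat k) * scaled_quot F t (n - k) y)"
  proof (cases n)
    case 0
    then show ?thesis by simp
  next
    case (Suc m)
    have "of_nat n * quot_at (F n) (x + y + t * of_nat n) = (T x * S y) $ m"
      by (simp only: Suc T_nth[symmetric] TS)
    also have "\<dots> = (\<Sum>k=0..m. of_nat (Suc k) * quot_at (F (Suc k)) (x + t * of_nat (Suc k))
        * scaled_quot F t (Suc m - Suc k) y)"
      by (simp only: fps_mult_nth T_nth S_nth diff_Suc_Suc)
    also have "\<dots> = (\<Sum>k=1..n. of_nat k * quot_at (F k) (x + t * of_nat k)
        * scaled_quot F t (n - k) y)"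
      unfolding Suc One_nat_def by (rule sum.shift_bounds_cl_Suc_ivl[symmetric])
    finally show ?thesis .
  qed
qed

section \<open>The zero family and the case split on \<open>F 0\<close>\<close>

lemma doubling_family_eq_0:
  fixes F :: "nat \<Rightarrow> complex poly"
  assumes conv: "\<And>n x. poly (F n) (2 * x) = (\<Sum>k=0..n. poly (F k) x * poly (F (n - k)) x)"
    and F0: "F 0 = 0"
  shows "F n = 0"
proof (induction n rule: less_induct)
  case (less n)
  have "poly (F n) (2 * x) = 0" for x
  proof -
    \<comment> \<open>For \<open>k\<close> < \<open>n\<close> the first factor vanishes by
      induction; for \<open>k = n\<close> the second one is \<open>F 0\<close>.\<close>
    have "poly (F k) x * poly (F (n - k)) x = 0" if "k \<le> n" for k
      using less.IH[of k] F0 that by (cases "k = n") auto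
    then show ?thesis
      unfolding conv by (intro sum.neutral) auto
  qed
  from this[of "_ / 2"] show ?case
    by (intro poly_eq_poly_eq_iff[THEN iffD1]) auto
qed

theorem mainTheorem2:
  fixes F :: "nat \<Rightarrow> complex poly"
  assumes "\<And>n. degree (F n) \<le> n"
    and "\<And>n x. poly (F n) (2 * x) = (\<Sum>k=0..n. poly (F k) x * poly (F (n - k)) x)"
  shows "\<forall>(n::nat) (x::complex) (y::complex) (t::complex).
      scaled_quot F t n (x + y) = (\<Sum>k=0..n. scaled_quot F t k x * scaled_quot F t (n - k) y) \<and>
      of_nat n * quot_at (F n) (x + y + t * of_nat n)
        = (\<Sum>k=1..n. of_nat k * quot_at (F k) (x + t * of_nat k) * scaled_quot F t (n - k) y)"
proof -
  \<comment> \<open>The degree bound makes \<open>F 0\<close> a constant \<open>c\<close>, and the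
    convolution at index 0 gives \<open>c = c * c\<close>, so \<open>c\<close> is 0 or 1.\<close>
  obtain c where c: "F 0 = [:c:]"
    using assms(1)[of 0] by (auto elim: degree_eq_zeroE)
  have "c = c * c"
    using assms(2)[of 0 0] c by simp
  then consider "F 0 = 0" | "F 0 = 1"
    using c by (auto simp: one_pCons)
  then show ?thesis
  proof cases
    case 1
    then have "F = (\<lambda>n. 0)"
      using doubling_family_eq_0[of F, OF assms(2)] by blast
    then have "scaled_quot F t n x = 0" "quot_at (F n) x = 0" for t n x
      by (auto simp: scaled_quot_def quot_at_def)
    then show ?thesis
      by simp
  next
    case 2
    then show ?thesis
      using convolution_identities[of F, OF assms(2)] by simp
  qed
qed

end
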